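(* Let $X$ be a real Banach space with continuous dual $X^*$, let $A\colon X\rightrightarrows X^*$ be a maximally monotone linear relation, let $C$ be a nonempty closed convex subset of $X$, and suppose that $\operatorname{dom}A\cap\operatorname{int}C\neq\varnothing$. Then $A+N_C$ is maximally monotone.
   Context: A set-valued operator $A\colon X\rightrightarrows X^*$ assigns to each $x\in X$ a subset $Ax\subseteq X^*$; $\operatorname{gra}A:=\{(x,x^* )\in X\times X^*\mid x^*\in Ax\}$ and $\operatorname{dom}A:=\{x\in X\mid Ax\ne\varnothing\}$. $A$ is monotone if $\langle x-y,x^*-y^*\rangle\ge 0$ for all $(x,x^* ),(y,y^* )\in\operatorname{gra}A$, and maximally monotone if it is monotone and no monotone operator has a graph strictly containing $\operatorname{gra}A$. $A$ is a linear relation if $\operatorname{gra}A$ is a linear subspace. The sum is $(A+B)x:=Ax+Bx$ (Minkowski sum, empty if either set is empty). The normal cone operator $N_C\colon X\rightrightarrows X^*$ is $N_C(x):=\{x^*\in X^*\mid \sup_{c\in C}\langle c-x,x^*\rangle\le 0\}$ if $x\in C$, and $N_C(x):=\varnothing$ if $x\notin C$. $\operatorname{int}C$ is the norm interior of $C$. *)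

theory Defs
  imports "HOL-Analysis.Analysis" "HOL-Library.Set_Algebras"
begin

text \<open>
  The continuous dual of \<open>X\<close> is the type of bounded linear functionals on \<open>X\<close>, and the pairing
  \<open>\<langle>x, x*\<rangle>\<close> is \<open>blinfun_apply x* x\<close>.
\<close>

type_synonym 'a dual = "'a \<Rightarrow>\<^sub>L real"

type_synonym 'a set_op = "'a \<Rightarrow> 'a dual set"

definition gra :: "'a::real_normed_vector set_op \<Rightarrow> ('a \<times> 'a dual) set" where
  "gra A = {(x, xs). xs \<in> A x}"

definition op_dom :: "'a::real_normed_vector set_op \<Rightarrow> 'a set" where
  "op_dom A = {x. A x \<noteq> {}}"

definition monotone_op :: "'a::real_normed_vector set_op \<Rightarrow> bool" where
  "monotone_op A \<longleftrightarrow>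
     (\<forall>(x, xs) \<in> gra A. \<forall>(y, ys) \<in> gra A. 0 \<le> blinfun_apply (xs - ys) (x - y))"

definition maximally_monotone :: "'a::real_normed_vector set_op \<Rightarrow> bool" where
  "maximally_monotone A \<longleftrightarrow>
     monotone_op A \<and> \<not> (\<exists>B :: 'a set_op. monotone_op B \<and> gra A \<subset> gra B)"

definition linear_relation :: "'a::real_normed_vector set_op \<Rightarrow> bool" where
  "linear_relation A \<longleftrightarrow> subspace (gra A)"

text \<open>The \<open>+\<close> on the right-hand side is the Minkowski sum of sets.\<close>

definition op_sum :: "'a::real_normed_vector set_op \<Rightarrow> 'a set_op \<Rightarrow> 'a set_op" where
  "op_sum A B = (\<lambda>x. A x + B x)"

text \<open>
  The supremum is taken in the extended reals: on \<open>real\<close>, \<open>Sup\<close> is unspecified for sets that are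
  not bounded above.
\<close>

definition normal_cone :: "'a::real_normed_vector set \<Rightarrow> 'a set_op" where
  "normal_cone C x =
     (if x \<in> C then {xs. (SUP c\<in>C. ereal (blinfun_apply xs (c - x))) \<le> 0} else {})"

end

theory Submission
  imports Defs
begin

text \<open>Let \<open>(z, zs)\<close> be monotonically related to \<open>A + N\<^sub>C\<close>. Then \<open>z\<close> lies in the closure of
  \<open>dom A\<close>, because \<open>Ax\<close> absorbs the annihilator of \<open>dom A\<close>. If \<open>z\<close> were outside \<open>C\<close>, a segment
  from the interior point to some \<open>y \<in> dom A\<close> near \<open>z\<close> would leave \<open>C\<close> at a point of \<open>dom A\<close> with a
  normal that strictly separates \<open>z\<close>; large multiples of it contradict monotone relatedness. So
  \<open>z \<in> C\<close>. As \<open>gra A\<close> is a subspace, \<open>\<langle>x - z, a - zs\<rangle>\<close> is convex on it, and it is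
  nonnegative where \<open>x \<in> C\<close>; the interior point is a Slater condition, so the constraint \<open>x \<in> C\<close>
  has a Lagrange multiplier \<open>n\<close>, and maximality of \<open>A\<close> gives \<open>zs + n \<in> Az\<close> with
  \<open>- n \<in> N\<^sub>C(z)\<close>.\<close>

section \<open>Sublinear functionals\<close>

definition sublinear :: "('a::real_vector \<Rightarrow> real) \<Rightarrow> bool" where
  "sublinear p \<longleftrightarrow> (\<forall>x y. p (x + y) \<le> p x + p y) \<and> (\<forall>t>0. \<forall>x. p (t *\<^sub>R x) \<le> t * p x)"

lemma sublinearI:
  assumes "\<And>x y. p (x + y) \<le> p x + p y" "\<And>t x. 0 < t \<Longrightarrow> p (t *\<^sub>R x) \<le> t * p x"
  shows "sublinear p"
  using assms by (auto simp: sublinear_def)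

lemma sublinear_add: "sublinear p \<Longrightarrow> p (x + y) \<le> p x + p y"
  by (auto simp: sublinear_def)

lemma sublinear_zero:
  assumes "sublinear p" shows "p 0 = 0"
proof -
  have "p (0 + 0) \<le> p 0 + p 0" "p ((1/2) *\<^sub>R 0) \<le> (1/2) * p 0"
    using assms zero_less_one half_gt_zero unfolding sublinear_def by blast+
  then show ?thesis by simp
qed

text \<open>Applying the defining inequality also to the reciprocal scalar turns it into an
  equality.\<close>

lemma sublinear_scaleR:
  assumes "sublinear p" "0 \<le> t" shows "p (t *\<^sub>R x) = t * p x"
proof (cases "t = 0")
  case False
  then have t: "0 < t" using assms by simp
  have 1: "p (t *\<^sub>R x) \<le> t * p x" using assms t by (auto simp: sublinear_def)
  have "p (inverse t *\<^sub>R (t *\<^sub>R x)) \<le> inverse t * p (t *\<^sub>R x)"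
    using assms t unfolding sublinear_def by (metis inverse_positive_iff_positive)
  then have "t * p x \<le> p (t *\<^sub>R x)" using t by (simp add: field_simps)
  with 1 show ?thesis by simp
qed (simp add: sublinear_zero assms)

lemma sublinear_minus: "sublinear p \<Longrightarrow> - p (- x) \<le> p x"
  using sublinear_add[of p x "- x"] sublinear_zero[of p] by simp

text \<open>Together with \<open>sublinear_minus\<close>, \<open>odd\<close> makes \<open>p\<close>
  an odd function. Superadditivity then follows by splitting \<open>x\<close> as
  \<open>(x + y) + (- y)\<close>, and negative scalars reduce to positive ones.\<close>

lemma sublinear_odd_imp_linear:
  assumes p: "sublinear p" and odd: "\<And>x. p (- x) \<le> - p x"
  shows "linear p"
proof -
  have m: "p (- x) = - p x" for x
    using odd[of x] sublinear_minus[OF p, of x] by simp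
  show ?thesis
  proof (rule linearI)
    fix x y
    have "p (x + y + - y) \<le> p (x + y) + p (- y)" by (rule sublinear_add[OF p])
    then show "p (x + y) = p x + p y"
      using sublinear_add[OF p, of x y] m[of y] by simp
  next
    fix t x
    show "p (t *\<^sub>R x) = t *\<^sub>R p x"
    proof (cases "0 \<le> t")
      case True
      then show ?thesis using sublinear_scaleR[OF p] by simp
    next
      case False
      then have "p ((- t) *\<^sub>R x) = - t * p x" by (intro sublinear_scaleR[OF p]) simp
      then show ?thesis using m[of "t *\<^sub>R x"] by simp
    qed
  qed
qed

section \<open>The Hahn-Banach theorem in Lagrange multiplier form\<close>

lemma convexD_ratio:
  fixes a b :: real
  assumes "convex C" "x \<in> C" "y \<in> C" "0 < a" "0 < b"
  shows "(a / (a + b)) *\<^sub>R x + (b / (a + b)) *\<^sub>R y \<in> C"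
  using assms by (intro convexD) (auto simp flip: add_divide_distrib)

text \<open>\<open>T\<close> is the infimal convolution of \<open>S\<close> with the cone generated
  by \<open>G\<close>. It is the largest sublinear functional below \<open>S\<close> with the
  required bounds, since any such functional is at most \<open>S (x + l *\<^sub>R v) + l * s\<close>
  at \<open>x\<close>.\<close>

lemma sublinear_smaller:
  fixes S :: "'a::real_vector \<Rightarrow> real"
  assumes S: "sublinear S" and "convex G" "G \<noteq> {}"
    and G: "\<And>v s. (v, s) \<in> G \<Longrightarrow> 0 \<le> S v + s"
  obtains T where "sublinear T" "\<And>x. T x \<le> S x" "\<And>v s. (v, s) \<in> G \<Longrightarrow> T (- v) \<le> s"
proof
  define U where "U x = {S (x + l *\<^sub>R v) + l * s | l v s. 0 < l \<and> (v, s) \<in> G}" for x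
  define T where "T x = Inf (U x)" for x
  obtain v0 s0 where g0: "(v0, s0) \<in> G" using \<open>G \<noteq> {}\<close> by auto
  \<comment> \<open>The hypothesis on \<open>G\<close>, scaled by \<open>l\<close>, keeps the
    infimum finite.\<close>
  have lb: "- S (- x) \<le> r" if "r \<in> U x" for x r
  proof -
    from that obtain l v s where r: "r = S (x + l *\<^sub>R v) + l * s" "0 < l" "(v, s) \<in> G"
      by (auto simp: U_def)
    have "S (l *\<^sub>R v) \<le> S (- x) + S (x + l *\<^sub>R v)"
      using sublinear_add[OF S, of "- x" "x + l *\<^sub>R v"] by simp
    moreover have "0 \<le> l * (S v + s)" using G r by simp
    ultimately show ?thesis
      using sublinear_scaleR[OF S, of l v] r by (simp add: algebra_simps)
  qed
  have bdd: "bdd_below (U x)" for x using lb by (meson bdd_belowI)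
  have ne: "U x \<noteq> {}" for x
    unfolding U_def using g0 zero_less_one[where 'a=real] by blast
  have mem: "S (x + l *\<^sub>R v) + l * s \<in> U x" if "0 < l" "(v, s) \<in> G" for x l v s
    unfolding U_def using that by blast
  have T_le: "T x \<le> S (x + l *\<^sub>R v) + l * s" if "0 < l" "(v, s) \<in> G" for x l v s
    unfolding T_def by (rule cInf_lower[OF mem[OF that] bdd])
  show "sublinear T"
  proof (rule sublinearI)
    fix x y
    have "T (x + y) \<le> a + b" if "a \<in> U x" "b \<in> U y" for a b
    proof -
      from that obtain l v s m w r where a: "a = S (x + l *\<^sub>R v) + l * s" "0 < l" "(v, s) \<in> G"
        and b: "b = S (y + m *\<^sub>R w) + m * r" "0 < m" "(w, r) \<in> G"
        by (auto simp: U_def)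
      \<comment> \<open>With weights in the ratio \<open>l : m\<close>, the
        \<open>(l + m)\<close>-fold of \<open>e\<close> is exactly \<open>l\<close> times the first
        pair plus \<open>m\<close> times the second.\<close>
      define e where "e = (l / (l + m)) *\<^sub>R (v, s) + (m / (l + m)) *\<^sub>R (w, r)"
      have "e \<in> G"
        unfolding e_def using \<open>convex G\<close> a b by (intro convexD_ratio) auto
      moreover have "e = (fst e, snd e)" by simp
      ultimately have "T (x + y) \<le> S (x + y + (l + m) *\<^sub>R fst e) + (l + m) * snd e"
        using a b by (intro T_le) auto
      also have "(l + m) *\<^sub>R fst e = l *\<^sub>R v + m *\<^sub>R w"
        using a b by (simp add: e_def scaleR_add_right)
      also have "(l + m) * snd e = l * s + m * r"
        using a b by (simp add: e_def distrib_left)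
      also have "x + y + (l *\<^sub>R v + m *\<^sub>R w) = (x + l *\<^sub>R v) + (y + m *\<^sub>R w)" by simp
      finally show ?thesis
        using sublinear_add[OF S, of "x + l *\<^sub>R v" "y + m *\<^sub>R w"] a b by linarith
    qed
    then have "T (x + y) - b \<le> T x" if "b \<in> U y" for b
      unfolding T_def[of x] using that by (intro cInf_greatest[OF ne]) (simp add: diff_le_eq)
    then have "T (x + y) - T x \<le> T y"
      unfolding T_def[of y] by (intro cInf_greatest[OF ne]) (simp add: algebra_simps)
    then show "T (x + y) \<le> T x + T y" by simp
  next
    fix t :: real and x :: 'a assume t: "0 < t"
    have "T (t *\<^sub>R x) / t \<le> a" if "a \<in> U x" for a
    proof -
      from that obtain l v s where a: "a = S (x + l *\<^sub>R v) + l * s" "0 < l" "(v, s) \<in> G"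
        by (auto simp: U_def)
      have "T (t *\<^sub>R x) \<le> S (t *\<^sub>R x + (t * l) *\<^sub>R v) + (t * l) * s"
        using a t by (intro T_le) auto
      also have "t *\<^sub>R x + (t * l) *\<^sub>R v = t *\<^sub>R (x + l *\<^sub>R v)" by (simp add: scaleR_add_right)
      finally show ?thesis
        using sublinear_scaleR[OF S, of t "x + l *\<^sub>R v"] t a by (simp add: field_simps)
    qed
    then have "T (t *\<^sub>R x) / t \<le> T x" unfolding T_def[of x] by (intro cInf_greatest[OF ne])
    then show "T (t *\<^sub>R x) \<le> t * T x" using t by (simp add: field_simps)
  qed
  show "T x \<le> S x" for x
  proof (rule field_le_epsilon)
    fix e :: real assume "0 < e"
    \<comment> \<open>Letting \<open>l\<close> tend to 0 costs at most \<open>l * M\<close>; the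
      summand 1 keeps \<open>M\<close> positive, so that \<open>l = e / M\<close> makes
      sense.\<close>
    define M where "M = \<bar>S v0 + s0\<bar> + 1"
    have M: "0 < M" "S v0 + s0 \<le> M" by (auto simp: M_def)
    define l where "l = e / M"
    have l: "0 < l" using M \<open>0 < e\<close> by (simp add: l_def)
    have "T x \<le> S (x + l *\<^sub>R v0) + l * s0" by (rule T_le[OF l g0])
    also have "\<dots> \<le> S x + l * (S v0 + s0)"
      using sublinear_add[OF S, of x "l *\<^sub>R v0"] sublinear_scaleR[OF S, of l v0] l
      by (simp add: algebra_simps)
    also have "l * (S v0 + s0) \<le> l * M" using M l by simp
    also have "l * M = e" using M by (simp add: l_def)
    finally show "T x \<le> S x + e" by simp
  qed
  show "T (- v) \<le> s" if "(v, s) \<in> G" for v s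
    using T_le[of 1 v s "- v"] that sublinear_zero[OF S] by simp
qed

text \<open>Zorn's lemma for the reversed pointwise order. A nonempty chain has its pointwise
  infimum as lower bound, which is finite because every member is at least \<open>- p (- x)\<close>
  at \<open>x\<close>.\<close>

lemma minimal_sublinear:
  fixes p :: "'a::real_vector \<Rightarrow> real"
  assumes p: "sublinear p"
  obtains q where "sublinear q" "q \<le> p" "\<And>r. sublinear r \<Longrightarrow> r \<le> q \<Longrightarrow> r = q"
proof -
  define A where "A = {q. sublinear q \<and> q \<le> p}"
  have "\<exists>m\<in>A. \<forall>a\<in>A. m \<ge> a \<longrightarrow> a = m"
  proof (rule predicate_Zorn)
    show "partial_order_on A (relation_of (\<lambda>x y. y \<le> x) A)"
      by (rule partial_order_on_relation_ofI) auto
  next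
    fix K assume K: "K \<in> Chains (relation_of (\<lambda>x y. y \<le> x) A)"
    then have KA: "K \<subseteq> A" and chain: "\<And>f g. f \<in> K \<Longrightarrow> g \<in> K \<Longrightarrow> f \<le> g \<or> g \<le> f"
      by (auto simp: Chains_def relation_of_def)
    show "\<exists>u\<in>A. \<forall>a\<in>K. u \<le> a"
    proof (cases "K = {}")
      case True
      then show ?thesis using p by (auto simp: A_def)
    next
      case False
      define u where "u x = (INF q\<in>K. q x)" for x
      have "- p (- x) \<le> q x" if "q \<in> K" for q x
        using that KA sublinear_minus[of q x] le_funD[of q p "- x"] by (fastforce simp: A_def)
      then have bdd: "bdd_below ((\<lambda>q. q x) ` K)" for x by (meson bdd_belowI2)
      have u_le: "u x \<le> q x" if "q \<in> K" for q x
        unfolding u_def by (rule cINF_lower[OF bdd that])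
      have "sublinear u"
      proof (rule sublinearI)
        fix x y
        have "u (x + y) \<le> f x + g y" if fg: "f \<in> K" "g \<in> K" for f g
        proof -
          \<comment> \<open>In a chain, one member lies below both \<open>f\<close> and
            \<open>g\<close>; its subadditivity passes to the infimum.\<close>
          obtain h where h: "h \<in> K" "h \<le> f" "h \<le> g" using chain[OF fg] fg by blast
          have "u (x + y) \<le> h (x + y)" by (rule u_le[OF h(1)])
          also have "\<dots> \<le> h x + h y" using h(1) KA by (auto simp: A_def intro: sublinear_add)
          also have "\<dots> \<le> f x + g y" using h by (intro add_mono) (auto dest: le_funD)
          finally show ?thesis .
        qed
        then have "u (x + y) - g y \<le> u x" if "g \<in> K" for g
          unfolding u_def[of x] using that
          by (intro cINF_greatest[OF False]) (simp add: diff_le_eq)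
        then have "u (x + y) - u x \<le> u y"
          unfolding u_def[of y] by (intro cINF_greatest[OF False]) (simp add: algebra_simps)
        then show "u (x + y) \<le> u x + u y" by simp
      next
        fix t :: real and x :: 'a assume t: "0 < t"
        have "u (t *\<^sub>R x) / t \<le> q x" if "q \<in> K" for q
        proof -
          have "u (t *\<^sub>R x) \<le> q (t *\<^sub>R x)" by (rule u_le[OF that])
          also have "\<dots> = t * q x" using that KA t by (auto simp: A_def sublinear_scaleR)
          finally show ?thesis using t by (simp add: field_simps)
        qed
        then have "u (t *\<^sub>R x) / t \<le> u x" unfolding u_def[of x] by (intro cINF_greatest[OF False])
        then show "u (t *\<^sub>R x) \<le> t * u x" using t by (simp add: field_simps)
      qed
      moreover obtain q where "q \<in> K" using False by blast
      then have "u \<le> p" using u_le[of q] KA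
        by (auto simp: A_def le_fun_def intro: order_trans)
      ultimately show ?thesis using u_le by (auto simp: A_def le_fun_def)
    qed
  qed
  then obtain q where "q \<in> A" "\<And>a. a \<in> A \<Longrightarrow> a \<le> q \<Longrightarrow> a = q" by blast
  then show ?thesis by (intro that[of q]) (auto simp: A_def)
qed

text \<open>A form of the Hahn--Banach theorem (Mazur--Orlicz, or Simons' ``Hahn--Banach--Lagrange''):
  besides the extension and separation theorems it contains the existence of Lagrange multipliers,
  with \<open>G\<close> the epigraph of the value of a convex program.\<close>

theorem hahn_banach_lagrange:
  fixes S :: "'a::real_vector \<Rightarrow> real"
  assumes "sublinear S" "convex G" "G \<noteq> {}"
    and "\<And>v s. (v, s) \<in> G \<Longrightarrow> 0 \<le> S v + s"
  obtains f where "linear f" "\<And>x. f x \<le> S x" "\<And>v s. (v, s) \<in> G \<Longrightarrow> 0 \<le> f v + s"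
proof -
  obtain T where T: "sublinear T" "\<And>x. T x \<le> S x" "\<And>v s. (v, s) \<in> G \<Longrightarrow> T (- v) \<le> s"
    using sublinear_smaller[OF assms] by blast
  obtain q where q: "sublinear q" "q \<le> T" "\<And>r. sublinear r \<Longrightarrow> r \<le> q \<Longrightarrow> r = q"
    using minimal_sublinear[OF T(1)] by blast
  have "q (- x) \<le> - q x" for x
  proof -
    \<comment> \<open>For this singleton the hypothesis reads \<open>q x - q x \<ge> 0\<close>. The
      resulting \<open>r\<close> lies below \<open>q\<close>, so minimality forces
      \<open>r = q\<close>, and the bound on \<open>r (- x)\<close> becomes oddness of
      \<open>q\<close>.\<close>
    obtain r where r: "sublinear r" "\<And>y. r y \<le> q y"
        "\<And>v s. (v, s) \<in> {(x, - q x)} \<Longrightarrow> r (- v) \<le> s"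
      using sublinear_smaller[OF q(1), of "{(x, - q x)}"] by auto
    then have "r = q" by (intro q(3)) (auto simp: le_fun_def)
    with r(3)[of x "- q x"] show ?thesis by simp
  qed
  then have lin: "linear q" by (rule sublinear_odd_imp_linear[OF q(1)])
  show ?thesis
  proof (rule that[OF lin])
    show "q x \<le> S x" for x using le_funD[OF q(2), of x] T(2)[of x] by simp
    show "0 \<le> q v + s" if "(v, s) \<in> G" for v s
      using le_funD[OF q(2), of "- v"] T(3)[OF that] linear_neg[OF lin, of v] by simp
  qed
qed

text \<open>The bound on \<open>S\<close>, used at \<open>x\<close> and at \<open>- x\<close>, makes
  the linear functional continuous.\<close>

lemma hahn_banach_lagrange_blinfun:
  fixes S :: "'a::real_normed_vector \<Rightarrow> real"
  assumes "sublinear S" "convex G" "G \<noteq> {}"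
    and "\<And>v s. (v, s) \<in> G \<Longrightarrow> 0 \<le> S v + s"
    and K: "\<And>x. S x \<le> K * norm x"
  obtains f :: "'a \<Rightarrow>\<^sub>L real" where "\<And>x. blinfun_apply f x \<le> S x"
    "\<And>v s. (v, s) \<in> G \<Longrightarrow> 0 \<le> blinfun_apply f v + s"
proof -
  obtain f where f: "linear f" "\<And>x. f x \<le> S x" "\<And>v s. (v, s) \<in> G \<Longrightarrow> 0 \<le> f v + s"
    using hahn_banach_lagrange[OF assms(1-4)] by blast
  have "norm (f x) \<le> norm x * K" for x
  proof -
    have "f x \<le> K * norm x" "f (- x) \<le> K * norm (- x)" using f(2) K order_trans by blast+
    then show ?thesis using linear_neg[OF f(1), of x] by (simp add: abs_le_iff mult.commute)
  qed
  then have "bounded_linear f"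
    using f(1) by (auto simp: bounded_linear_def bounded_linear_axioms_def)
  then show ?thesis
    using f by (intro that[of "Blinfun f"]) (auto simp: bounded_linear_Blinfun_apply)
qed

lemma sublinear_norm: "0 \<le> K \<Longrightarrow> sublinear (\<lambda>x. K * norm x)"
  by (rule sublinearI) (simp_all add: norm_triangle_ineq mult_left_mono flip: distrib_left)

lemma hahn_banach_lagrange_norm:
  fixes G :: "('a::real_normed_vector \<times> real) set"
  assumes "convex G" "G \<noteq> {}" "0 \<le> K" "\<And>v s. (v, s) \<in> G \<Longrightarrow> 0 \<le> K * norm v + s"
  obtains f :: "'a \<Rightarrow>\<^sub>L real" where "\<And>v s. (v, s) \<in> G \<Longrightarrow> 0 \<le> blinfun_apply f v + s"
proof (rule hahn_banach_lagrange_blinfun[of "\<lambda>v. K * norm v" G K])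
  show "sublinear (\<lambda>v::'a. K * norm v)" using assms(3) by (rule sublinear_norm)
qed (use assms that in auto)

section \<open>Annihilators and supporting functionals\<close>

text \<open>A multiplier for the translate of \<open>V\<close> by \<open>- z\<close>, which stays at
  distance at least \<open>d\<close> from 0, satisfies \<open>f v - f z \<ge> d\<close> on
  \<open>V\<close>. A linear functional bounded below on a subspace vanishes there, and rescaling
  normalizes its value at \<open>z\<close>.\<close>

lemma annihilator_not_in_closure:
  fixes V :: "'a::real_normed_vector set"
  assumes V: "subspace V" and z: "z \<notin> closure V"
  obtains f :: "'a \<Rightarrow>\<^sub>L real" where "\<And>x. x \<in> V \<Longrightarrow> blinfun_apply f x = 0" "blinfun_apply f z = 1"
proof -
  obtain d where d: "0 < d" "\<And>v. v \<in> V \<Longrightarrow> d \<le> dist v z"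
    using z by (auto simp: closure_approachable not_less)
  define G where "G = (\<lambda>v. (v - z, - d)) ` V"
  have "convex G"
  proof (rule convexI)
    fix a b u w assume ab: "a \<in> G" "b \<in> G" and uw: "0 \<le> u" "0 \<le> w" "u + w = (1::real)"
    then obtain x y where xy: "a = (x - z, - d)" "b = (y - z, - d)" "x \<in> V" "y \<in> V"
      by (auto simp: G_def)
    have "u *\<^sub>R x + w *\<^sub>R y \<in> V" using V xy by (simp add: subspace_add subspace_scale)
    moreover have "u *\<^sub>R a + w *\<^sub>R b =
        (u *\<^sub>R x + w *\<^sub>R y - (u + w) *\<^sub>R z, - ((u + w) * d))"
      unfolding xy by (simp add: algebra_simps)
    ultimately show "u *\<^sub>R a + w *\<^sub>R b \<in> G" unfolding G_def uw(3) by simp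
  qed
  have ne: "G \<noteq> {}" using subspace_0[OF V] by (auto simp: G_def)
  have "0 \<le> 1 * norm v + s" if "(v, s) \<in> G" for v s
  proof -
    from that obtain x where "x \<in> V" "v = x - z" "s = - d" by (auto simp: G_def)
    then show ?thesis using d(2)[of x] by (simp add: dist_norm)
  qed
  then obtain f :: "'a \<Rightarrow>\<^sub>L real" where f: "\<And>v s. (v, s) \<in> G \<Longrightarrow> 0 \<le> blinfun_apply f v + s"
    using hahn_banach_lagrange_norm[OF \<open>convex G\<close> ne zero_le_one] by blast
  have ge: "d \<le> f v - f z" if "v \<in> V" for v
    using f[of "v - z" "- d"] that by (simp add: G_def blinfun.diff_right)
  have fz: "d \<le> - f z" using ge[OF subspace_0[OF V]] by (simp add: blinfun.zero_right)
  have f0: "f v = 0" if v: "v \<in> V" for v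
  proof (rule ccontr)
    assume nz: "f v \<noteq> 0"
    \<comment> \<open>This multiple of \<open>v\<close> has the value \<open>f z\<close> under
      \<open>f\<close>, which contradicts the gap \<open>d > 0\<close>.\<close>
    have "((f z) / f v) *\<^sub>R v \<in> V" using V v by (rule subspace_scale)
    from ge[OF this] nz d(1) show False by (simp add: blinfun.scaleR_right)
  qed
  show ?thesis
    using f0 fz d(1)
    by (intro that[of "(1 / f z) *\<^sub>R f"]) (auto simp: blinfun.scaleR_left)
qed

text \<open>The functional attains at \<open>y - x0\<close> its bound by the gauge of \<open>C - x0\<close>, and \<open>t\<close> is the reciprocal of that
  gauge at \<open>y - x0\<close>.\<close>

lemma gauge_support:
  fixes C :: "'a::real_normed_vector set"
  assumes C: "convex C" "closed C" and r: "0 < r" "cball x0 r \<subseteq> C" and z: "z \<notin> C"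
  obtains e where "0 < e" "\<And>y. norm (y - z) < e \<Longrightarrow>
    \<exists>t>0. \<exists>f :: 'a \<Rightarrow>\<^sub>L real. x0 + t *\<^sub>R (y - x0) \<in> C \<and>
      (\<forall>c\<in>C. f (c - (x0 + t *\<^sub>R (y - x0))) \<le> 0) \<and> 0 < f (z - (x0 + t *\<^sub>R (y - x0)))"
proof -
  \<comment> \<open>\<open>p\<close> is the gauge of \<open>C - x0\<close>; the ball around
    \<open>x0\<close> makes it finite and bounded by \<open>norm v / r\<close>.\<close>
  define U where "U v = {t. 0 < t \<and> x0 + (1 / t) *\<^sub>R v \<in> C}" for v
  define p where "p v = Inf (U v)" for v
  have bdd: "bdd_below (U v)" for v by (rule bdd_belowI[of _ 0]) (auto simp: U_def)
  have x0C: "x0 \<in> C" using r by auto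
  have U_norm: "t \<in> U v" if "0 < t" "norm v / r \<le> t" for t v
  proof -
    have "norm ((1 / t) *\<^sub>R v) \<le> r" using that r by (simp add: field_simps)
    then have "x0 + (1 / t) *\<^sub>R v \<in> cball x0 r" by (simp add: dist_norm)
    then show ?thesis using that r by (auto simp: U_def)
  qed
  have ne: "U v \<noteq> {}" for v
  proof -
    have "norm v / r + 1 \<in> U v" using r by (intro U_norm) (auto intro: add_nonneg_pos)
    then show ?thesis by blast
  qed
  have p_le: "p v \<le> t" if "t \<in> U v" for t v unfolding p_def by (rule cInf_lower[OF that bdd])
  have p_nonneg: "0 \<le> p v" for v
    unfolding p_def by (rule cInf_greatest[OF ne]) (auto simp: U_def)
  have p_norm: "p v \<le> 1 / r * norm v" for v
  proof (rule field_le_epsilon)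
    fix e :: real assume "0 < e"
    then have "norm v / r + e \<in> U v" using r by (intro U_norm) (auto intro: add_nonneg_pos)
    from p_le[OF this] show "p v \<le> 1 / r * norm v + e" by simp
  qed
  have sub: "sublinear p"
  proof (rule sublinearI)
    fix v w
    have "p (v + w) \<le> a + b" if "a \<in> U v" "b \<in> U w" for a b
    proof (rule p_le)
      have ab: "0 < a" "0 < b" using that by (auto simp: U_def)
      have "(a / (a + b)) *\<^sub>R (x0 + (1 / a) *\<^sub>R v) + (b / (a + b)) *\<^sub>R (x0 + (1 / b) *\<^sub>R w) \<in> C"
        using that C(1) ab by (intro convexD_ratio) (auto simp: U_def)
      also have "(a / (a + b)) *\<^sub>R (x0 + (1 / a) *\<^sub>R v) + (b / (a + b)) *\<^sub>R (x0 + (1 / b) *\<^sub>R w)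
          = (a / (a + b) + b / (a + b)) *\<^sub>R x0 + (1 / (a + b)) *\<^sub>R (v + w)"
        using ab by (simp add: algebra_simps)
      also have "a / (a + b) + b / (a + b) = 1" using ab by (simp flip: add_divide_distrib)
      finally show "a + b \<in> U (v + w)" using ab by (simp add: U_def)
    qed
    then have "p (v + w) - b \<le> p v" if "b \<in> U w" for b
      unfolding p_def[of v] using that by (intro cInf_greatest[OF ne]) (simp add: diff_le_eq)
    then have "p (v + w) - p v \<le> p w"
      unfolding p_def[of w] by (intro cInf_greatest[OF ne]) (simp add: algebra_simps)
    then show "p (v + w) \<le> p v + p w" by simp
  next
    fix t :: real and v :: 'a assume t: "0 < t"
    have "p (t *\<^sub>R v) / t \<le> a" if "a \<in> U v" for a
    proof -
      have "t * a \<in> U (t *\<^sub>R v)" using that t by (simp add: U_def)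
      from p_le[OF this] show ?thesis using t by (simp add: field_simps)
    qed
    then have "p (t *\<^sub>R v) / t \<le> p v" unfolding p_def[of v] by (intro cInf_greatest[OF ne])
    then show "p (t *\<^sub>R v) \<le> t * p v" using t by (simp add: field_simps)
  qed
  \<comment> \<open>Convexity with \<open>x0\<close> gives membership for every scale above the
    gauge; closedness of \<open>C\<close> then yields the scale \<open>g\<close> itself in the limit
    from the right.\<close>
  have inC: "x0 + (1 / g) *\<^sub>R v \<in> C" if g: "p v \<le> g" "0 < g" for v g
  proof -
    have up: "x0 + (1 / t) *\<^sub>R v \<in> C" if t: "g < t" for t
    proof -
      obtain a where a: "a \<in> U v" "a < t"
        using t g cInf_lessD[OF ne, of v t] by (force simp: p_def)
      have "0 < a" using a by (simp add: U_def)
      have "(1 - a / t) *\<^sub>R x0 + (a / t) *\<^sub>R (x0 + (1 / a) *\<^sub>R v) \<in> C"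
        using a x0C \<open>0 < a\<close> by (intro convexD[OF C(1)]) (auto simp: U_def)
      then show ?thesis using \<open>0 < a\<close> by (simp add: algebra_simps)
    qed
    have "((\<lambda>t. x0 + (1 / t) *\<^sub>R v) \<longlongrightarrow> x0 + (1 / g) *\<^sub>R v) (at_right g)"
      using g by (intro tendsto_intros) auto
    then show ?thesis
      using up by (intro Lim_in_closed_set[OF C(2) _ trivial_limit_at_right_real])
        (auto simp: eventually_at_filter)
  qed
  define g where "g = p (z - x0)"
  have g: "1 < g"
  proof (rule ccontr)
    assume "\<not> 1 < g"
    then have "x0 + (1 / 1) *\<^sub>R (z - x0) \<in> C" by (intro inC) (auto simp: g_def)
    with z show False by simp
  qed
  \<comment> \<open>Replacing \<open>z\<close> by \<open>y\<close> changes gauge and functional by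
    at most \<open>q\<close>. This radius ensures \<open>2 * q < g - 1\<close>, so the gauge at
    \<open>y - x0\<close> exceeds \<open>1 + q\<close>, and the functional at \<open>z - x0\<close>
    still exceeds 1.\<close>
  define e where "e = r * (g - 1) / 2"
  show ?thesis
  proof (rule that[of e])
    show "0 < e" using r g by (simp add: e_def)
    fix y assume "norm (y - z) < e"
    define q where "q = 1 / r * norm (y - z)"
    have yz: "q < (g - 1) / 2"
      using r \<open>norm (y - z) < e\<close> by (simp add: q_def e_def field_simps)
    define h where "h = p (y - x0)"
    have "g \<le> p (y - x0) + p (z - y)"
      unfolding g_def using sublinear_add[OF sub, of "y - x0" "z - y"] by simp
    moreover have "p (z - y) \<le> q"
      using p_norm[of "z - y"] by (simp add: q_def norm_minus_commute)
    ultimately have h: "1 + q < h" unfolding h_def using yz by (simp add: field_simps)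
    have "0 \<le> q" using r by (simp add: q_def)
    then have h1: "1 < h" using h by linarith
    \<comment> \<open>The singleton forces \<open>f (y - x0) \<ge> h\<close>, hence equality with
      the gauge.\<close>
    have "0 \<le> p v + s" if "(v, s) \<in> {(y - x0, - h)}" for v s using that by (simp add: h_def)
    from hahn_banach_lagrange_blinfun[where S = p, OF sub convex_singleton insert_not_empty this p_norm]
    obtain f :: "'a \<Rightarrow>\<^sub>L real" where f: "\<And>x. f x \<le> p x"
        "\<And>v s. (v, s) \<in> {(y - x0, - h)} \<Longrightarrow> 0 \<le> f v + s"
      by blast
    have fy: "f (y - x0) = h" using f(1)[of "y - x0"] f(2)[of "y - x0" "- h"] by (simp add: h_def)
    \<comment> \<open>The point where the ray from \<open>x0\<close> through \<open>y\<close> leaves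
      \<open>C\<close>; there \<open>f (x - x0) = 1\<close>, the bound of \<open>f\<close> on
      \<open>C - x0\<close>.\<close>
    define x where "x = x0 + (1 / h) *\<^sub>R (y - x0)"
    have fx: "f (v - x) = f (v - x0) - 1" for v
    proof -
      have "f (v - x) = f (v - x0) - (1 / h) * f (y - x0)"
        by (simp add: x_def blinfun.diff_right blinfun.add_right blinfun.scaleR_right)
      then show ?thesis using fy h1 by simp
    qed
    have "x \<in> C" unfolding x_def using h1 by (intro inC) (auto simp: h_def)
    moreover have "f (c - x) \<le> 0" if "c \<in> C" for c
    proof -
      have "1 \<in> U (c - x0)" using that by (simp add: U_def)
      from p_le[OF this] f(1)[of "c - x0"] show ?thesis by (simp add: fx)
    qed
    moreover have "0 < f (z - x)"
    proof -
      have "f (z - x0) = h - f (y - z)"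
        unfolding fy[symmetric] by (simp add: blinfun.diff_right)
      moreover have "f (y - z) \<le> q" unfolding q_def using f(1) p_norm order_trans by blast
      ultimately show ?thesis using h by (simp add: fx)
    qed
    ultimately show "\<exists>t>0. \<exists>f :: 'a \<Rightarrow>\<^sub>L real. x0 + t *\<^sub>R (y - x0) \<in> C \<and>
      (\<forall>c\<in>C. f (c - (x0 + t *\<^sub>R (y - x0))) \<le> 0) \<and> 0 < f (z - (x0 + t *\<^sub>R (y - x0)))"
      using h1 unfolding x_def by (intro exI[of _ "1 / h"]) auto
  qed
qed

section \<open>Normal cones, maximality and the closure of the domain\<close>

lemma in_normal_cone:
  "xs \<in> normal_cone C x \<longleftrightarrow> x \<in> C \<and> (\<forall>c\<in>C. blinfun_apply xs (c - x) \<le> 0)"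
  by (auto simp: normal_cone_def SUP_le_iff)

lemma monotone_opD:
  "monotone_op A \<Longrightarrow> xs \<in> A x \<Longrightarrow> ys \<in> A y \<Longrightarrow> 0 \<le> blinfun_apply (xs - ys) (x - y)"
  unfolding monotone_op_def gra_def by blast

lemma monotone_opI:
  "(\<And>x xs y ys. xs \<in> A x \<Longrightarrow> ys \<in> A y \<Longrightarrow> 0 \<le> blinfun_apply (xs - ys) (x - y)) \<Longrightarrow> monotone_op A"
  unfolding monotone_op_def gra_def by blast

text \<open>Adjoining one monotonically related pair to the graph keeps it monotone, so maximality
  forces the pair to be there already. Conversely, every pair of a larger monotone graph is related
  to \<open>A\<close>.\<close>

lemma maximally_monotone_iff:
  "maximally_monotone A \<longleftrightarrow> monotone_op A \<and>
    (\<forall>z zs. (\<forall>x. \<forall>xs\<in>A x. 0 \<le> blinfun_apply (xs - zs) (x - z)) \<longrightarrow> zs \<in> A z)"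
    (is "?L \<longleftrightarrow> ?R")
proof
  assume L: ?L
  then have mono: "monotone_op A" by (simp add: maximally_monotone_def)
  have "zs \<in> A z" if rel: "\<forall>x. \<forall>xs\<in>A x. 0 \<le> blinfun_apply (xs - zs) (x - z)" for z zs
  proof (rule ccontr)
    assume n: "zs \<notin> A z"
    define B where "B x = (if x = z then insert zs (A x) else A x)" for x
    have "0 \<le> blinfun_apply (zs - xs) (z - x)" if "xs \<in> A x" for x xs
      using rel that by (force simp: blinfun.diff_left blinfun.diff_right)
    then have "monotone_op B"
      using rel monotone_opD[OF mono]
      by (intro monotone_opI) (auto simp: B_def split: if_splits)
    moreover have "gra A \<subset> gra B" using n by (auto simp: gra_def B_def)
    ultimately show False using L by (auto simp: maximally_monotone_def)
  qed
  with mono show ?R by blast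
next
  assume R: ?R
  have False if B: "monotone_op B" "gra A \<subset> gra B" for B
  proof -
    obtain z zs where z: "zs \<in> B z" "zs \<notin> A z" using B(2) by (auto simp: gra_def)
    have "0 \<le> blinfun_apply (xs - zs) (x - z)" if "xs \<in> A x" for x xs
      using B that z by (intro monotone_opD[OF B(1)]) (auto simp: gra_def)
    with R z show False by blast
  qed
  with R show ?L by (auto simp: maximally_monotone_def)
qed

lemma monotone_op_sum_normal_cone:
  assumes "monotone_op A" shows "monotone_op (op_sum A (normal_cone C))"
proof (rule monotone_opI)
  fix x xs y ys
  assume "xs \<in> op_sum A (normal_cone C) x" "ys \<in> op_sum A (normal_cone C) y"
  then obtain a n b m where *: "xs = a + n" "a \<in> A x" "n \<in> normal_cone C x"
      "ys = b + m" "b \<in> A y" "m \<in> normal_cone C y"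
    by (auto simp: op_sum_def elim!: set_plus_elim)
  have "0 \<le> blinfun_apply (a - b) (x - y)" using assms * by (intro monotone_opD)
  moreover have "n (y - x) \<le> 0" "m (x - y) \<le> 0" using * by (auto simp: in_normal_cone)
  ultimately show "0 \<le> blinfun_apply (xs - ys) (x - y)"
    unfolding * by (simp add: blinfun.bilinear_simps)
qed

text \<open>\<open>Ax + (dom A)\<^sup>\<bottom> = Ax\<close> by maximality, so the values are unbounded in the directions of the
  annihilator.\<close>

lemma related_in_closure_dom:
  fixes A :: "'a::real_normed_vector set_op"
  assumes max: "maximally_monotone A" and lin: "linear_relation A"
    and x0: "x0 \<in> op_dom A"
    and bd: "\<And>xs. xs \<in> A x0 \<Longrightarrow> 0 \<le> blinfun_apply (xs - zs) (x0 - z)"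
  shows "z \<in> closure (op_dom A)"
proof (rule ccontr)
  assume z: "z \<notin> closure (op_dom A)"
  have "op_dom A = fst ` gra A" by (force simp: op_dom_def gra_def)
  then have "subspace (op_dom A)"
    using lin linear_subspace_image[OF linear_fst] by (simp add: linear_relation_def)
  from annihilator_not_in_closure[OF this z] obtain f :: "'a \<Rightarrow>\<^sub>L real"
    where f: "\<And>x. x \<in> op_dom A \<Longrightarrow> f x = 0" "f z = 1" by blast
  obtain a where a: "a \<in> A x0" using x0 by (auto simp: op_dom_def)
  have mono: "monotone_op A" using max by (simp add: maximally_monotone_iff)
  have mem: "a + t *\<^sub>R f \<in> A x0" for t
  proof -
    have "0 \<le> blinfun_apply (xs - (a + t *\<^sub>R f)) (x - x0)" if "xs \<in> A x" for x xs
    proof -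
      have "f x = 0" "f x0 = 0" using f(1) x0 that by (auto simp: op_dom_def)
      with monotone_opD[OF mono that a] show ?thesis
        by (simp add: blinfun.bilinear_simps)
    qed
    then show ?thesis using max by (auto simp: maximally_monotone_iff)
  qed
  \<comment> \<open>Since \<open>f (x0 - z) = -1\<close>, moving along \<open>f\<close> decreases
    the pairing without bound.\<close>
  have "0 \<le> blinfun_apply (a - zs) (x0 - z) - t" for t
    using bd[OF mem, of t] f(1)[OF x0] f(2) by (simp add: blinfun.bilinear_simps)
  from this[of "blinfun_apply (a - zs) (x0 - z) + 1"] show False by simp
qed

section \<open>The Lagrange multiplier for the constraint\<close>

text \<open>The two sides differ by exactly \<open>u * w * (a - b) (x - y)\<close>, which is
  nonnegative by monotonicity.\<close>

lemma convex_shifted_pairing: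
  fixes A :: "'a::real_normed_vector set_op"
  assumes mono: "monotone_op A" and "a \<in> A x" "b \<in> A y" "0 \<le> u" "0 \<le> w" "u + w = 1"
  shows "(u *\<^sub>R a + w *\<^sub>R b - zs) (u *\<^sub>R x + w *\<^sub>R y - z) \<le> u * (a - zs) (x - z) + w * (b - zs) (y - z)"
proof -
  have w: "w = 1 - u" using assms by simp
  have "0 \<le> u * w * (a - b) (x - y)" using assms monotone_opD[OF mono, of a x b y] by simp
  also have "\<dots> = u * (a - zs) (x - z) + w * (b - zs) (y - z) -
      (u *\<^sub>R a + w *\<^sub>R b - zs) (u *\<^sub>R x + w *\<^sub>R y - z)"
    unfolding w by (simp add: blinfun.bilinear_simps) algebra
  finally show ?thesis by simp
qed

text \<open>Minimize \<open>h\<close> over the graph subject to \<open>x \<in> C\<close>, and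
  perturb the constraint by \<open>v = c - x\<close>. \<open>G\<close> collects perturbations with
  upper bounds for \<open>h\<close>, and \<open>n\<close> is a multiplier for it. Convexity of
  \<open>G\<close> uses that the graph is linear and that \<open>h\<close> is convex on it.\<close>

lemma sum_multiplier:
  fixes A :: "'a::real_normed_vector set_op"
  assumes mono: "monotone_op A" and lin: "linear_relation A" and C: "convex C"
    and x0: "a0 \<in> A x0" "0 < r" "cball x0 r \<subseteq> C"
    and rel: "\<And>x a. a \<in> A x \<Longrightarrow> x \<in> C \<Longrightarrow> 0 \<le> (a - zs) (x - z)"
  obtains n :: "'a \<Rightarrow>\<^sub>L real" where
    "\<And>x a c. a \<in> A x \<Longrightarrow> c \<in> C \<Longrightarrow> 0 \<le> n (c - x) + (a - zs) (x - z)"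
proof -
  have comb: "u *\<^sub>R a + w *\<^sub>R b \<in> A (u *\<^sub>R x + w *\<^sub>R y)" if "a \<in> A x" "b \<in> A y" for u w a b x y
  proof -
    have "u *\<^sub>R (x, a) + w *\<^sub>R (y, b) \<in> gra A"
      using lin that unfolding linear_relation_def
      by (intro subspace_add subspace_scale) (auto simp: gra_def)
    then show ?thesis by (simp add: gra_def)
  qed
  define h where "h x a = (a - zs) (x - z)" for x and a :: "'a dual"
  \<comment> \<open>The Slater constant: the value at the interior point divided by the radius of
    its ball bounds how fast the value can become negative as the violation \<open>norm v\<close>
    grows.\<close>
  define K where "K = h x0 a0 / r"
  have x0C: "x0 \<in> C" using x0 by auto
  have K: "0 \<le> K" using rel[OF x0(1) x0C] x0(2) by (simp add: K_def h_def)
  define G where "G = {(c - x, s) | c x a s. a \<in> A x \<and> c \<in> C \<and> h x a \<le> s}"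
  have "convex G"
  proof (rule convexI)
    fix p q u w assume pq: "p \<in> G" "q \<in> G" and uw: "0 \<le> u" "0 \<le> w" "u + w = (1::real)"
    from pq obtain c x a s d y b t where p: "p = (c - x, s)" "a \<in> A x" "c \<in> C" "h x a \<le> s"
      and q: "q = (d - y, t)" "b \<in> A y" "d \<in> C" "h y b \<le> t"
      unfolding G_def by blast
    have "h (u *\<^sub>R x + w *\<^sub>R y) (u *\<^sub>R a + w *\<^sub>R b) \<le> u * h x a + w * h y b"
      unfolding h_def using mono p(2) q(2) uw by (rule convex_shifted_pairing)
    also have "\<dots> \<le> u * s + w * t" using p q uw by (intro add_mono mult_left_mono) auto
    finally have "h (u *\<^sub>R x + w *\<^sub>R y) (u *\<^sub>R a + w *\<^sub>R b) \<le> u * s + w * t" .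
    moreover have "u *\<^sub>R a + w *\<^sub>R b \<in> A (u *\<^sub>R x + w *\<^sub>R y)" using comb p q by blast
    moreover have "u *\<^sub>R c + w *\<^sub>R d \<in> C" using C p q uw by (intro convexD) auto
    moreover have "u *\<^sub>R p + w *\<^sub>R q =
        ((u *\<^sub>R c + w *\<^sub>R d) - (u *\<^sub>R x + w *\<^sub>R y), u * s + w * t)"
      using p q by (simp add: algebra_simps)
    ultimately show "u *\<^sub>R p + w *\<^sub>R q \<in> G" unfolding G_def by blast
  qed
  have ne: "G \<noteq> {}" using x0 x0C unfolding G_def by blast
  have "0 \<le> K * norm v + s" if "(v, s) \<in> G" for v s
  proof -
    from that obtain c x a where v: "v = c - x" "a \<in> A x" "c \<in> C" "h x a \<le> s"
      unfolding G_def by blast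
    define d where "d = norm v"
    \<comment> \<open>Chosen so that \<open>t * r = (1 - t) * d\<close>: the ball scaled by
      \<open>t\<close> is just large enough to absorb the remaining violation.\<close>
    define t where "t = d / (d + r)"
    have d: "0 \<le> d" "0 < d + r" using x0(2) by (auto simp: d_def add_nonneg_pos)
    have "1 - t = (d + r - d) / (d + r)" unfolding diff_divide_distrib using d by (simp add: t_def)
    then have t: "0 \<le> t" "0 < 1 - t" "1 - t = r / (d + r)"
      using d x0(2) by (auto simp: t_def)
    \<comment> \<open>Moving from \<open>x\<close> towards \<open>x0\<close> by the fraction \<open>t\<close> reaches \<open>C\<close>.\<close>
    define w where "w = - (r / d) *\<^sub>R v"
    \<comment> \<open>For \<open>v = 0\<close> the quotient \<open>r / d\<close> is 0 by convention,
      so \<open>w = 0\<close> and the bound still holds.\<close>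
    have "norm w \<le> r" using x0(2) d by (simp add: w_def d_def)
    then have wC: "x0 + w \<in> C" using x0(3) by (auto simp: dist_norm)
    have "t *\<^sub>R w = - ((1 - t) *\<^sub>R v)"
    proof (cases "v = 0")
      case False
      then have "t * (r / d) = 1 - t" unfolding t(3) using d by (simp add: t_def d_def)
      then show ?thesis by (simp add: w_def)
    qed (simp add: w_def)
    then have "(1 - t) *\<^sub>R x + t *\<^sub>R x0 = (1 - t) *\<^sub>R c + t *\<^sub>R (x0 + w)"
      unfolding v by (simp add: algebra_simps)
    also have "\<dots> \<in> C" using C v wC t by (intro convexD) auto
    finally have "0 \<le> h ((1 - t) *\<^sub>R x + t *\<^sub>R x0) ((1 - t) *\<^sub>R a + t *\<^sub>R a0)"
      unfolding h_def using comb[OF v(2) x0(1)] by (intro rel)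
    also have "\<dots> \<le> (1 - t) * h x a + t * h x0 a0"
      unfolding h_def using mono v(2) x0(1) t by (intro convex_shifted_pairing) auto
    \<comment> \<open>By the choice of \<open>t\<close> and \<open>K\<close>,
      \<open>t * h x0 a0 = (1 - t) * K * d\<close>.\<close>
    also have "\<dots> = (1 - t) * (h x a + K * d)"
      using d x0(2) by (simp add: t(3) K_def distrib_left) (simp add: t_def)
    finally have "0 \<le> h x a + K * d" using t(2) by (metis mult_pos_neg not_less)
    then show ?thesis using v by (simp add: d_def)
  qed
  then obtain n :: "'a \<Rightarrow>\<^sub>L real" where n: "\<And>v s. (v, s) \<in> G \<Longrightarrow> 0 \<le> n v + s"
    using hahn_banach_lagrange_norm[OF \<open>convex G\<close> ne K] by blast
  show ?thesis
  proof (rule that)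
    fix x a c assume "a \<in> A x" "c \<in> C"
    then have "(c - x, h x a) \<in> G" unfolding G_def by blast
    from n[OF this] show "0 \<le> n (c - x) + (a - zs) (x - z)" by (simp add: h_def)
  qed
qed

section \<open>Maximality of the sum\<close>

theorem corollary5p8:
  fixes A :: "'a::banach \<Rightarrow> ('a \<Rightarrow>\<^sub>L real) set"
    and C :: "'a set"
  assumes "maximally_monotone A"
    and "linear_relation A"
    and "C \<noteq> {}"
    and "closed C"
    and "convex C"
    and "op_dom A \<inter> interior C \<noteq> {}"
  shows "maximally_monotone (op_sum A (normal_cone C))"
proof -
  have mono: "monotone_op A" using assms(1) by (simp add: maximally_monotone_iff)
  obtain x0 a0 where a0: "a0 \<in> A x0" and "x0 \<in> interior C"
    using assms(6) by (auto simp: op_dom_def)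
  then obtain r where r: "0 < r" "cball x0 r \<subseteq> C" by (auto simp: mem_interior_cball)
  have x0C: "x0 \<in> C" using r by auto
  have "zs \<in> op_sum A (normal_cone C) z"
    if "\<forall>x. \<forall>xs\<in>op_sum A (normal_cone C) x. 0 \<le> blinfun_apply (xs - zs) (x - z)" for z zs
  proof -
    have relN: "0 \<le> blinfun_apply (a + n - zs) (x - z)" if "a \<in> A x" "n \<in> normal_cone C x" for x a n
      using that \<open>\<forall>x. \<forall>xs\<in>_ x. _\<close> by (auto simp: op_sum_def)
    have rel: "0 \<le> blinfun_apply (a - zs) (x - z)" if "a \<in> A x" "x \<in> C" for x a
      using relN[of a x 0] that by (simp add: in_normal_cone)
    have "z \<in> closure (op_dom A)"
      using assms(1,2) _ rel[OF _ x0C]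
      by (rule related_in_closure_dom) (use a0 in \<open>auto simp: op_dom_def\<close>)
    have zC: "z \<in> C"
    proof (rule ccontr)
      assume "z \<notin> C"
      from gauge_support[OF assms(5,4) r this] obtain e where e: "0 < e"
        "\<And>y. norm (y - z) < e \<Longrightarrow>
          \<exists>t>0. \<exists>f :: 'a \<Rightarrow>\<^sub>L real. x0 + t *\<^sub>R (y - x0) \<in> C \<and>
            (\<forall>c\<in>C. f (c - (x0 + t *\<^sub>R (y - x0))) \<le> 0) \<and> 0 < f (z - (x0 + t *\<^sub>R (y - x0)))"
        by blast
      obtain y b where y: "b \<in> A y" "norm (y - z) < e"
        using \<open>z \<in> closure _\<close> e(1) by (force simp: closure_approachable op_dom_def dist_norm)
      obtain t and f :: "'a \<Rightarrow>\<^sub>L real" where tf: "x0 + t *\<^sub>R (y - x0) \<in> C"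
        "\<forall>c\<in>C. blinfun_apply f (c - (x0 + t *\<^sub>R (y - x0))) \<le> 0"
        "0 < blinfun_apply f (z - (x0 + t *\<^sub>R (y - x0)))"
        using e(2)[OF y(2)] by blast
      define x where "x = x0 + t *\<^sub>R (y - x0)"
      \<comment> \<open>Linearity of the graph moves the dual component along with \<open>x\<close>,
        so \<open>x\<close> stays in the domain.\<close>
      define a where "a = a0 + t *\<^sub>R (b - a0)"
      have "(x0, a0) + t *\<^sub>R ((y, b) - (x0, a0)) \<in> gra A"
        using assms(2) a0 y(1) unfolding linear_relation_def
        by (intro subspace_add subspace_scale subspace_diff) (auto simp: gra_def)
      then have a: "a \<in> A x" by (simp add: gra_def x_def a_def)
      have fx: "0 < f (z - x)" using tf by (simp add: x_def)
      \<comment> \<open>This multiple of the normal \<open>f\<close> outweighs the pairing at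
        \<open>(x, a)\<close> by exactly 1; it is nonnegative, so it remains in the normal
        cone.\<close>
      define s where "s = ((a - zs) (x - z) + 1) / f (z - x)"
      have "0 \<le> (a - zs) (x - z)" using rel a tf by (simp add: x_def)
      then have "0 \<le> s" using fx by (simp add: s_def)
      then have "s *\<^sub>R f \<in> normal_cone C x"
        using tf by (auto simp: in_normal_cone x_def blinfun.scaleR_left mult_nonneg_nonpos)
      from relN[OF a this] have "0 \<le> (a - zs) (x - z) - s * f (z - x)"
        by (simp add: blinfun.bilinear_simps algebra_simps)
      also have "s * f (z - x) = (a - zs) (x - z) + 1" using fx by (simp add: s_def)
      finally show False by simp
    qed
    obtain n :: "'a \<Rightarrow>\<^sub>L real" where n:
      "\<And>x a c. a \<in> A x \<Longrightarrow> c \<in> C \<Longrightarrow> 0 \<le> n (c - x) + (a - zs) (x - z)"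
      using sum_multiplier[OF mono assms(2,5) a0 r rel] by blast
    \<comment> \<open>Taking \<open>c = z\<close> turns the multiplier inequality into monotone
      relatedness of \<open>(z, zs + n)\<close> to \<open>A\<close>.\<close>
    have "0 \<le> blinfun_apply (a - (zs + n)) (x - z)" if "a \<in> A x" for x a
      using n[OF that zC] by (simp add: blinfun.bilinear_simps)
    then have zA: "zs + n \<in> A z" using assms(1) by (auto simp: maximally_monotone_iff)
    \<comment> \<open>At the pair \<open>(z, zs + n)\<close> of the graph the pairing vanishes,
      which leaves \<open>n (c - z) \<ge> 0\<close> for all \<open>c\<close> in
      \<open>C\<close>.\<close>
    have "- n \<in> normal_cone C z"
      using zC n[OF zA] by (auto simp: in_normal_cone blinfun.minus_left)
    then have "(zs + n) + - n \<in> A z + normal_cone C z" using zA by (intro set_plus_intro)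
    then show ?thesis by (simp add: op_sum_def)
  qed
  with monotone_op_sum_normal_cone[OF mono] show ?thesis by (simp add: maximally_monotone_iff)
qed

end
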